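(* If $G$ is a connected unit interval graph, then $\operatorname{th}_{\rm pd}^{\times}(G)=\gamma(G)$.
   Context: All graphs are finite, simple and undirected with at least one vertex. A graph $G=(V,E)$ is a unit interval graph if each vertex $v\in V$ can be assigned a closed real interval $I(v)$ of length one such that, for distinct $x,y\in V$, $xy\in E$ if and only if $I(x)\cap I(y)\ne\emptyset$. Let $G$ be a graph. $\gamma(G)$ is the domination number: the minimum $|S|$ over $S\subseteq V(G)$ with $N[S]=V(G)$, where $N[S]$ is the closed neighborhood of $S$. For nonempty $S\subseteq V(G)$ define $P^{[0]}(S)=S$, $P^{[1]}(S)=N[S]$, and for $i\ge 1$, $P^{[i+1]}(S)=P^{[i]}(S)\cup\{w\in V(G)\setminus P^{[i]}(S): \exists u\in P^{[i]}(S),\ N(u)\setminus P^{[i]}(S)=\{w\}\}$. $S$ is a power dominating set if $P^{[t]}(S)=V(G)$ for some $t$. The power propagation time $\operatorname{pt}_{\rm pd}(G;S)$ is the least positive integer $t$ with $P^{[t]}(S)=V(G)$ (so it is at least $1$, even for $S=V(G)$), and is $\infty$ if $S$ is not a power dominating set. The product power throttling number is $\operatorname{th}_{\rm pd}^{\times}(G)=\min_{\emptyset\ne S\subseteq V(G)}|S|\operatorname{pt}_{\rm pd}(G;S)$. *)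

theory Defs
  imports Complex_Main "HOL-Library.Extended_Nat" "Graph_Theory.Digraph_Component"
begin

text \<open>
  Finite simple undirected graphs are the symmetric digraphs of the locale \<^locale>\<open>graph\<close>; the
  edge \<open>uv\<close> is present iff \<open>(u, v) \<in> arcs_ends G\<close>, written \<open>u \<rightarrow>\<^bsub>G\<^esub> v\<close>. The locale admits the graph
  without vertices.
\<close>

definition unit_interval_graph :: "('a, 'b) pre_digraph \<Rightarrow> bool" where
  "unit_interval_graph G \<longleftrightarrow>
     (\<exists>I :: 'a \<Rightarrow> real set.
        (\<forall>v \<in> verts G. \<exists>a. I v = {a..a + 1}) \<and>
        (\<forall>x \<in> verts G. \<forall>y \<in> verts G. x \<noteq> y \<longrightarrow> (x \<rightarrow>\<^bsub>G\<^esub> y \<longleftrightarrow> I x \<inter> I y \<noteq> {})))"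

definition nbhd :: "('a, 'b) pre_digraph \<Rightarrow> 'a \<Rightarrow> 'a set" where
  "nbhd G u = {v. u \<rightarrow>\<^bsub>G\<^esub> v}"

definition closed_nbhd :: "('a, 'b) pre_digraph \<Rightarrow> 'a set \<Rightarrow> 'a set" where
  "closed_nbhd G S = S \<union> (\<Union>u \<in> S. nbhd G u)"

definition dominating_set :: "('a, 'b) pre_digraph \<Rightarrow> 'a set \<Rightarrow> bool" where
  "dominating_set G S \<longleftrightarrow> S \<subseteq> verts G \<and> closed_nbhd G S = verts G"

definition domination_number :: "('a, 'b) pre_digraph \<Rightarrow> nat" where
  "domination_number G = Min (card ` {S. dominating_set G S})"

fun power_propagation :: "('a, 'b) pre_digraph \<Rightarrow> 'a set \<Rightarrow> nat \<Rightarrow> 'a set" where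
  "power_propagation G S 0 = S"
| "power_propagation G S (Suc 0) = closed_nbhd G S"
| "power_propagation G S (Suc (Suc i)) =
     (let P = power_propagation G S (Suc i)
      in P \<union> {w \<in> verts G - P. \<exists>u \<in> P. nbhd G u - P = {w}})"

definition power_dominating_set :: "('a, 'b) pre_digraph \<Rightarrow> 'a set \<Rightarrow> bool" where
  "power_dominating_set G S \<longleftrightarrow>
     S \<noteq> {} \<and> S \<subseteq> verts G \<and> (\<exists>t. power_propagation G S t = verts G)"

definition power_propagation_time :: "('a, 'b) pre_digraph \<Rightarrow> 'a set \<Rightarrow> enat" where
  "power_propagation_time G S =
     (if power_dominating_set G S
      then enat (LEAST t. 0 < t \<and> power_propagation G S t = verts G)
      else \<infinity>)"

definition product_power_throttling_number :: "('a, 'b) pre_digraph \<Rightarrow> enat" where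
  "product_power_throttling_number G =
     Min ((\<lambda>S. enat (card S) * power_propagation_time G S) ` {S. S \<noteq> {} \<and> S \<subseteq> verts G})"

end

theory Submission
  imports Defs
begin

text \<open>
  Order the vertices by the left endpoints of their intervals. Closed neighbourhoods are then
  intervals of this order, and connectedness makes consecutive vertices adjacent. A forced vertex
  is next to an observed one, since all vertices between it and its forcing neighbour are observed.
  So at time \<open>d + 1\<close> every observed vertex is at most \<open>d\<close> places away from \<open>N[s]\<close> for some \<open>s \<in> S\<close>,
  and the interval of vertices within \<open>d\<close> places of \<open>N[s]\<close> is dominated by \<open>d + 1\<close> vertices.
  Hence \<open>\<gamma>(G) \<le> |S| (d + 1)\<close>.
\<close>

section \<open>Closed neighbourhoods, edges across a cut, and sorted enumerations\<close>

lemma mem_closed_nbhd_singleton: "v \<in> closed_nbhd G {u} \<longleftrightarrow> v = u \<or> u \<rightarrow>\<^bsub>G\<^esub> v"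
  by (auto simp: closed_nbhd_def nbhd_def)

lemma closed_nbhd_conv: "closed_nbhd G S = (\<Union>s\<in>S. closed_nbhd G {s})"
  by (auto simp: closed_nbhd_def)

lemma (in wf_digraph) closed_nbhd_subset: "S \<subseteq> verts G \<Longrightarrow> closed_nbhd G S \<subseteq> verts G"
  by (auto simp: closed_nbhd_def nbhd_def)

lemma (in wf_digraph) adj_crosses_of_reachable:
  assumes "u \<rightarrow>\<^sup>* v" "u \<in> A" "v \<notin> A"
  obtains x y where "x \<in> A" "y \<notin> A" "x \<rightarrow> y"
  using assms by (induction arbitrary: thesis rule: reachable_induct) blast+

text \<open>Sorting a duplicate-free list by the key \<open>p\<close> gives distinct positions even
  to elements with equal key, so vertices with the same interval cause no trouble.\<close>

lemma sorted_enumeration: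
  fixes p :: "'a \<Rightarrow> 'b::linorder"
  assumes "finite V"
  obtains f where "bij_betw f {..<card V} V"
    and "\<And>i j. i \<le> j \<Longrightarrow> j < card V \<Longrightarrow> p (f i) \<le> p (f j)"
proof -
  obtain xs where xs: "set xs = V" "distinct xs"
    using finite_distinct_list[OF assms] by blast
  define ys where "ys = sort_key p xs"
  have ys: "set ys = V" "distinct ys" "length ys = card V" "sorted (map p ys)"
    using xs distinct_card[OF xs(2)] by (simp_all add: ys_def)
  show ?thesis
  proof
    show "bij_betw ((!) ys) {..<card V} V"
      using ys by (metis bij_betw_nth)
    show "p (ys ! i) \<le> p (ys ! j)" if "i \<le> j" "j < card V" for i j
      using sorted_nth_mono[OF ys(4), of i j] that ys(3) by simp
  qed
qed

section \<open>Vertex orderings with the umbrella property: propagation and domination along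
  them\<close>

locale umbrella_ordered_graph = graph G for G (structure) +
  fixes f :: "nat \<Rightarrow> 'a" and n :: nat
  assumes bij: "bij_betw f {..<n} (verts G)"
    and consecutive: "Suc i < n \<Longrightarrow> f i \<rightarrow> f (Suc i)"
    and umbrella: "i < j \<Longrightarrow> j < k \<Longrightarrow> k < n \<Longrightarrow> f i \<rightarrow> f k \<Longrightarrow> f i \<rightarrow> f j \<and> f j \<rightarrow> f k"
begin

lemma in_verts: "i < n \<Longrightarrow> f i \<in> verts G"
  using bij by (auto simp: bij_betw_def)

lemma index: assumes "v \<in> verts G" obtains i where "i < n" "v = f i"
  using bij assms by (auto simp: bij_betw_def)

lemma adj_sym: "u \<rightarrow> v \<Longrightarrow> v \<rightarrow> u"
  using arcs_ends_symmetric[OF sym_arcs] .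

definition near :: "nat \<Rightarrow> nat \<Rightarrow> bool" where
  "near i j \<longleftrightarrow> i = j \<or> f i \<rightarrow> f j"

lemma near_sym: "near i j \<Longrightarrow> near j i"
  by (auto simp: near_def adj_sym)

lemma near_Suc: "Suc i < n \<Longrightarrow> near i (Suc i)"
  by (simp add: near_def consecutive)

lemma near_between:
  assumes "near i k" "i \<le> j" "j \<le> k" "k < n"
  shows "near i j" "near j k"
  using assms umbrella[of i j k] by (auto simp: near_def le_less)

lemma near_closed_nbhd: "near i j \<Longrightarrow> f i \<in> D \<Longrightarrow> f j \<in> closed_nbhd G D"
  by (auto simp: near_def closed_nbhd_def nbhd_def)

lemma closed_nbhd_near:
  assumes "i < n" "j < n" "f j \<in> closed_nbhd G {f i}" shows "near i j"
  using assms bij by (auto simp: mem_closed_nbhd_singleton near_def bij_betw_def inj_on_def)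

text \<open>The two inequalities say that \<open>i\<close> and \<open>j\<close> differ by at most
  \<open>d\<close>, avoiding truncated subtraction.\<close>

definition block :: "nat \<Rightarrow> nat \<Rightarrow> nat set" where
  "block d c = {i. i < n \<and> (\<exists>j<n. near c j \<and> i \<le> j + d \<and> j \<le> i + d)}"

lemma block_Suc:
  assumes "i < n" "j \<in> block d c" "i \<le> Suc j" "j \<le> Suc i"
  shows "i \<in> block (Suc d) c"
proof -
  obtain k where "k < n" "near c k" "j \<le> k + d" "k \<le> j + d"
    using assms(2) by (auto simp: block_def)
  with assms show ?thesis unfolding block_def by force
qed

text \<open>The place next to \<open>w\<close> on the side of the forcing vertex \<open>f c\<close>
  lies between \<open>c\<close> and \<open>w\<close>, possibly at \<open>c\<close> itself. By the
  umbrella property it belongs to the closed neighbourhood of \<open>f c\<close>, in which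
  \<open>f w\<close> is the only unobserved vertex.\<close>

lemma forced_next_to_observed:
  assumes P: "P \<subseteq> verts G" and u: "u \<in> P" and w: "nbhd G u - P = {f w}" "w < n"
  obtains j where "f j \<in> P" "j < n" "w \<le> Suc j" "j \<le> Suc w"
proof -
  obtain c where c: "c < n" "u = f c" using P u index by blast
  have cw: "f c \<rightarrow> f w" "f w \<notin> P" using w c by (auto simp: nbhd_def)
  have obs: "f j \<in> P" if "near c j" "j \<noteq> w" "j < n" for j
  proof (rule ccontr)
    assume "f j \<notin> P"
    then have "f j \<in> nbhd G u - P" using that u c by (auto simp: near_def nbhd_def)
    then have "f j = f w" using w by auto
    then show False using bij that w by (auto simp: bij_betw_def inj_on_def)
  qed
  have near: "near c w" using cw by (simp add: near_def)
  have "c \<noteq> w" using cw u c by auto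
  then consider "c < w" | "w < c" by linarith
  then show ?thesis
  proof cases
    case 1
    then have "near c (w - 1)" using near_between(1)[OF near, of "w - 1"] w by simp
    then show ?thesis using that[of "w - 1"] obs[of "w - 1"] 1 w by simp
  next
    case 2
    then have "near c (Suc w)"
      using near_between(2)[OF near_sym[OF near], of "Suc w"] c near_sym by simp
    then show ?thesis using that[of "Suc w"] obs[of "Suc w"] 2 c by simp
  qed
qed

lemma power_propagation_subset:
  assumes "S \<subseteq> verts G"
  shows "power_propagation G S t \<subseteq> verts G"
  using assms closed_nbhd_subset
  by (induction G S t rule: power_propagation.induct) (auto simp: Let_def)

text \<open>At time 1 the observed set is the closed neighbourhood of \<open>S\<close>, which is
  distance 0. Each later round costs at most one more place.\<close>

lemma power_propagation_block:
  assumes "S \<subseteq> verts G" "i < n" "f i \<in> power_propagation G S (Suc d)"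
  shows "\<exists>c<n. f c \<in> S \<and> i \<in> block d c"
  using assms(2,3)
proof (induction d arbitrary: i)
  case 0
  then obtain s where s: "s \<in> S" "f i \<in> closed_nbhd G {s}"
    using closed_nbhd_conv[of G S] by auto
  then obtain c where c: "c < n" "s = f c" using assms(1) index by blast
  then have "near c i" using closed_nbhd_near 0 s by blast
  then show ?case using s c 0 by (auto simp: block_def)
next
  case (Suc d)
  let ?P = "power_propagation G S (Suc d)"
  consider "f i \<in> ?P" | u where "u \<in> ?P" "nbhd G u - ?P = {f i}"
    using Suc.prems(2) by (auto simp: Let_def)
  \<comment> \<open>Both cases fit one shape: a vertex observed earlier serves as its own witness,
    \<open>j = i\<close>.\<close>
  then obtain j where "f j \<in> ?P" "j < n" "i \<le> Suc j" "j \<le> Suc i"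
  proof cases
    case 1
    then show ?thesis using that[of i] Suc.prems by simp
  next
    case 2
    then show ?thesis
      using forced_next_to_observed[OF power_propagation_subset[OF assms(1)]] Suc.prems(1) that
      by blast
  qed
  then show ?case using Suc.IH[of j] block_Suc[OF Suc.prems(1)] by blast
qed

text \<open>The induction advances two rounds at a time. For \<open>d = 0\<close> the centre
  \<open>f c\<close> suffices. For \<open>d = 1\<close> the ends \<open>f a\<close> and
  \<open>f b\<close> cover everything up to \<open>c\<close> from either side, and one further place
  outwards. Raising \<open>d\<close> by two adds one vertex on each side: placed just beyond the
  covered range, it covers itself and the next place outwards.\<close>

lemma dominate_interval:
  assumes "a \<le> c" "c \<le> b" "b < n" "near a c" "near c b"
  shows "\<exists>D \<subseteq> verts G. card D \<le> Suc d \<and>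
           (\<forall>i<n. a \<le> i + d \<longrightarrow> i \<le> b + d \<longrightarrow> f i \<in> closed_nbhd G D)"
proof (induction d rule: induct_nat_012)
  case 0
  have "near c i" if "a \<le> i" "i \<le> b" for i
    using near_between(2)[OF assms(4), of i] near_between(1)[OF assms(5), of i] that assms near_sym
    by (cases "i \<le> c") auto
  then show ?case
    using assms in_verts near_closed_nbhd[of c _ "{f c}"] by (intro exI[of _ "{f c}"]) auto
next
  case 1
  have "near a i \<or> near b i" if i: "i < n" "a \<le> Suc i" "i \<le> Suc b" for i
  proof -
    consider "a = Suc i" | "a \<le> i" "i \<le> c" | "c \<le> i" "i \<le> b" | "i = Suc b"
      using i by linarith
    then show ?thesis
    proof cases
      case 1
      then show ?thesis using near_sym[OF near_Suc[of i]] assms by simp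
    next
      case 2
      then show ?thesis using near_between(1)[OF assms(4)] assms by simp
    next
      case 3
      then show ?thesis using near_sym[OF near_between(2)[OF assms(5)]] assms by simp
    next
      case 4
      then show ?thesis using near_Suc[of b] i by simp
    qed
  qed
  then have "f i \<in> closed_nbhd G {f a, f b}" if "i < n" "a \<le> Suc i" "i \<le> Suc b" for i
    using that near_closed_nbhd[of a i "{f a, f b}"] near_closed_nbhd[of b i "{f a, f b}"] by auto
  moreover have "card {f a, f b} \<le> Suc 1" by (simp add: card_insert_if)
  ultimately show ?case
    using assms in_verts by (intro exI[of _ "{f a, f b}"]) simp
next
  case (ge2 d)
  then obtain D where D: "D \<subseteq> verts G" "card D \<le> Suc d"
    "\<And>i. \<lbrakk>i < n; a \<le> i + d; i \<le> b + d\<rbrakk> \<Longrightarrow> f i \<in> closed_nbhd G D"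
    by blast
  \<comment> \<open>Clamped to \<open>{..<n}\<close>; where clamping occurs, the end of the order has already been reached.\<close>
  define l where "l = a - Suc d"
  define r where "r = min (b + Suc d) (n - 1)"
  let ?D = "insert (f l) (insert (f r) D)"
  have lr: "l < n" "r < n" using assms by (auto simp: l_def r_def)
  have "f i \<in> closed_nbhd G ?D" if i: "i < n" "a \<le> i + Suc (Suc d)" "i \<le> b + Suc (Suc d)" for i
  proof -
    consider "a \<le> i + d" "i \<le> b + d" | "i = l \<or> i = r" | "l = Suc i" | "i = Suc r"
      using i unfolding l_def r_def by linarith
    then show ?thesis
    proof cases
      case 1
      then show ?thesis using D(3)[of i] i by (auto simp: closed_nbhd_def)
    next
      case 2
      then show ?thesis by (auto simp: closed_nbhd_def)
    next
      case 3
      then have "near l i" using near_sym[OF near_Suc[of i]] lr by simp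
      then show ?thesis by (rule near_closed_nbhd) simp
    next
      case 4
      then have "near r i" using near_Suc[of r] i(1) by simp
      then show ?thesis by (rule near_closed_nbhd) simp
    qed
  qed
  moreover have "card ?D \<le> Suc (Suc (Suc d))"
    using D(2) finite_subset[OF D(1) finite_verts] by (simp add: card_insert_if)
  moreover have "?D \<subseteq> verts G" using D(1) lr in_verts by blast
  ultimately show ?case by blast
qed

text \<open>The closed neighbourhood of \<open>f c\<close> lies between its first and last
  positions. Both are near \<open>c\<close>, so \<open>dominate_interval\<close> applies to
  them.\<close>

lemma dominate_block:
  assumes "c < n"
  shows "\<exists>D \<subseteq> verts G. card D \<le> Suc d \<and> f ` block d c \<subseteq> closed_nbhd G D"
proof -
  define N where "N = {j. j < n \<and> near c j}"
  have N: "finite N" "c \<in> N" using assms by (auto simp: N_def near_def)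
  then have mem: "Min N \<in> N" "Max N \<in> N" using Min_in Max_in by blast+
  have bounds: "Min N \<le> j" "j \<le> Max N" if "j \<in> N" for j
    using N that by auto
  obtain D where D: "D \<subseteq> verts G" "card D \<le> Suc d"
    "\<forall>i<n. Min N \<le> i + d \<longrightarrow> i \<le> Max N + d \<longrightarrow> f i \<in> closed_nbhd G D"
    using dominate_interval[of "Min N" c "Max N" d] mem bounds[OF N(2)] near_sym
    by (auto simp: N_def)
  have "f i \<in> closed_nbhd G D" if i: "i \<in> block d c" for i
  proof -
    obtain j where j: "j \<in> N" "i \<le> j + d" "j \<le> i + d" "i < n"
      using i by (auto simp: block_def N_def)
    then show ?thesis using D(3) bounds[OF j(1)] by force
  qed
  then show ?thesis using D(1,2) by blast
qed

lemma dominating_set_of_power_propagation: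
  assumes "S \<subseteq> verts G" "power_propagation G S (Suc d) = verts G"
  obtains D where "dominating_set G D" "card D \<le> card S * Suc d"
proof -
  \<comment> \<open>The sets are chosen per vertex, while blocks are indexed by position. The inner
    quantifier ranges over the single position of \<open>s\<close>.\<close>
  have "\<forall>s\<in>S. \<exists>D. D \<subseteq> verts G \<and> card D \<le> Suc d \<and>
          (\<forall>c<n. s = f c \<longrightarrow> f ` block d c \<subseteq> closed_nbhd G D)"
  proof
    fix s assume "s \<in> S"
    then obtain c where c: "c < n" "s = f c" using assms(1) index by blast
    moreover have "c' = c" if "c' < n" "s = f c'" for c'
      using that c bij by (auto simp: bij_betw_def inj_on_def)
    ultimately show "\<exists>D. D \<subseteq> verts G \<and> card D \<le> Suc d \<and>
        (\<forall>c<n. s = f c \<longrightarrow> f ` block d c \<subseteq> closed_nbhd G D)"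
      using dominate_block[of c d] by blast
  qed
  then obtain D where D: "\<And>s. s \<in> S \<Longrightarrow> D s \<subseteq> verts G" "\<And>s. s \<in> S \<Longrightarrow> card (D s) \<le> Suc d"
    "\<And>c. c < n \<Longrightarrow> f c \<in> S \<Longrightarrow> f ` block d c \<subseteq> closed_nbhd G (D (f c))"
    by metis
  show ?thesis
  proof
    have "v \<in> closed_nbhd G (\<Union>s\<in>S. D s)" if v: "v \<in> verts G" for v
    proof -
      obtain i where i: "i < n" "v = f i" using v index by blast
      then obtain c where c: "c < n" "f c \<in> S" "i \<in> block d c"
        using power_propagation_block[OF assms(1), of i d] assms(2) v by auto
      then have "v \<in> closed_nbhd G (D (f c))" using D(3) i by blast
      then show ?thesis using c(2) by (auto simp: closed_nbhd_def)
    qed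
    then show "dominating_set G (\<Union>s\<in>S. D s)"
      unfolding dominating_set_def using D(1) closed_nbhd_subset[of "\<Union>s\<in>S. D s"] by blast
    have "finite S" using assms(1) finite_verts by (rule finite_subset)
    then have "card (\<Union>s\<in>S. D s) \<le> (\<Sum>s\<in>S. card (D s))" by (rule card_UN_le)
    also have "\<dots> \<le> card S * Suc d" using sum_bounded_above[of S "\<lambda>s. card (D s)" "Suc d"] D(2) by simp
    finally show "card (\<Union>s\<in>S. D s) \<le> card S * Suc d" .
  qed
qed

end

section \<open>Umbrella orderings of connected unit interval graphs\<close>

lemma connected_unit_interval_graph_umbrella_ordered:
  assumes "graph G" "Digraph_Component.connected G" "unit_interval_graph G"
  obtains f where "umbrella_ordered_graph G f (card (verts G))"
proof -
  interpret graph G by fact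
  obtain I where I: "\<And>v. v \<in> verts G \<Longrightarrow> \<exists>a. I v = {a..a + 1::real}"
    "\<And>x y. \<lbrakk>x \<in> verts G; y \<in> verts G; x \<noteq> y\<rbrakk> \<Longrightarrow> x \<rightarrow>\<^bsub>G\<^esub> y \<longleftrightarrow> I x \<inter> I y \<noteq> {}"
    using assms(3) unfolding unit_interval_graph_def by metis
  obtain p where p: "\<And>v. v \<in> verts G \<Longrightarrow> I v = {p v..p v + 1}"
    using I(1) by metis
  \<comment> \<open>Closed intervals of length one meet exactly when their left endpoints differ by
    at most 1.\<close>
  have adj: "x \<rightarrow>\<^bsub>G\<^esub> y \<longleftrightarrow> \<bar>p x - p y\<bar> \<le> 1" if "x \<in> verts G" "y \<in> verts G" "x \<noteq> y" for x y
    using I(2)[OF that] that by (auto simp: p)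
  let ?n = "card (verts G)"
  obtain f where f: "bij_betw f {..<?n} (verts G)"
    and mono: "\<And>i j. i \<le> j \<Longrightarrow> j < ?n \<Longrightarrow> p (f i) \<le> p (f j)"
    using sorted_enumeration[OF finite_verts, of p] by blast
  have fv: "f i \<in> verts G" if "i < ?n" for i using f that by (auto simp: bij_betw_def)
  have inj: "f i = f j \<longleftrightarrow> i = j" if "i < ?n" "j < ?n" for i j
    using f that by (auto simp: bij_betw_def inj_on_def)
  have "umbrella_ordered_graph G f ?n"
  proof unfold_locales
    show "bij_betw f {..<?n} (verts G)" by (rule f)
  next
    fix i assume i: "Suc i < ?n"
    \<comment> \<open>Connectedness yields an edge from the first \<open>i + 1\<close> vertices to
      the remaining ones. The left endpoints of its ends enclose those of \<open>f i\<close> and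
      \<open>f (Suc i)\<close>, which therefore also differ by at most 1.\<close>
    have "f i \<rightarrow>\<^sup>*\<^bsub>G\<^esub> f (Suc i)"
      using assms(2) fv[of i] fv[OF i] i
      by (simp add: connected_def strongly_connected_def reachable_mk_symmetric_eq[OF sym_arcs])
    moreover have "f i \<in> f ` {..i}" "f (Suc i) \<notin> f ` {..i}"
      using i inj by auto
    ultimately obtain x y where xy: "x \<in> f ` {..i}" "y \<notin> f ` {..i}" "x \<rightarrow>\<^bsub>G\<^esub> y"
      by (rule adj_crosses_of_reachable)
    then obtain j where j: "j \<le> i" "x = f j" by blast
    obtain k where k: "k < ?n" "y = f k"
      using adj_in_verts(2)[OF xy(3)] f by (auto simp: bij_betw_def)
    have ik: "Suc i \<le> k" using xy(2) k by (meson atMost_iff image_eqI not_less_eq_eq)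
    have "\<bar>p (f j) - p (f k)\<bar> \<le> 1"
      using adj[of "f j" "f k"] xy(3) j k ik i fv inj[of j k] by auto
    then have "\<bar>p (f i) - p (f (Suc i))\<bar> \<le> 1"
      using mono[of j i] mono[of i "Suc i"] mono[of "Suc i" k] i j k ik by simp
    then show "f i \<rightarrow>\<^bsub>G\<^esub> f (Suc i)"
      using adj[of "f i" "f (Suc i)"] fv i inj[of i "Suc i"] by simp
  next
    fix i j k assume ijk: "i < j" "j < k" "k < ?n" "f i \<rightarrow>\<^bsub>G\<^esub> f k"
    then have "\<bar>p (f i) - p (f k)\<bar> \<le> 1"
      using adj[of "f i" "f k"] fv inj[of i k] by simp
    then show "f i \<rightarrow>\<^bsub>G\<^esub> f j \<and> f j \<rightarrow>\<^bsub>G\<^esub> f k"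
      using adj[of "f i" "f j"] adj[of "f j" "f k"] mono[of i j] mono[of j k] ijk fv
        inj[of i j] inj[of j k] by simp
  qed
  then show ?thesis by (rule that)
qed

section \<open>Minimum dominating sets and propagation times\<close>

lemma (in fin_digraph) finite_dominating_sets: "finite {S. dominating_set G S}"
  by (rule finite_subset[of _ "Pow (verts G)"]) (auto simp: dominating_set_def)

lemma (in fin_digraph) domination_number_le: "dominating_set G D \<Longrightarrow> domination_number G \<le> card D"
  unfolding domination_number_def using finite_dominating_sets by simp

lemma (in wf_digraph) dominating_set_verts: "dominating_set G (verts G)"
  using closed_nbhd_subset[of "verts G"] by (auto simp: dominating_set_def closed_nbhd_def)

lemma (in fin_digraph) minimum_dominating_set:
  obtains D where "dominating_set G D" "card D = domination_number G"
proof -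
  have "domination_number G \<in> card ` {S. dominating_set G S}"
    unfolding domination_number_def using finite_dominating_sets dominating_set_verts
    by (intro Min_in) auto
  then show ?thesis using that by auto
qed

lemma power_propagation_time_dominating_set:
  assumes "dominating_set G D" "D \<noteq> {}"
  shows "power_propagation_time G D = 1"
proof -
  have one: "power_propagation G D (Suc 0) = verts G" using assms by (simp add: dominating_set_def)
  then have "power_dominating_set G D"
    using assms unfolding power_dominating_set_def dominating_set_def by blast
  moreover have "(LEAST t. 0 < t \<and> power_propagation G D t = verts G) = 1"
    using one by (intro Least_equality) auto
  ultimately show ?thesis by (simp add: power_propagation_time_def one_enat_def)
qed

lemma (in wf_digraph) power_propagation_time_cases:
  obtains "power_propagation_time G S = \<infinity>"
  | d where "power_propagation_time G S = enat (Suc d)" "power_propagation G S (Suc d) = verts G"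
proof (cases "power_dominating_set G S")
  case False
  then show ?thesis using that(1) by (simp add: power_propagation_time_def)
next
  case True
  let ?Q = "\<lambda>t. 0 < t \<and> power_propagation G S t = verts G"
  obtain t where t: "power_propagation G S t = verts G"
    using True by (auto simp: power_dominating_set_def)
  have "\<exists>t. ?Q t"
  proof (cases t)
    \<comment> \<open>Observing everything at time 0 means that \<open>S\<close> is the whole vertex
      set, which also observes everything at time 1. So a positive time exists.\<close>
    case 0
    then have "?Q (Suc 0)" using t dominating_set_verts by (simp add: dominating_set_def)
    then show ?thesis by blast
  next
    case (Suc d)
    then show ?thesis using t by blast
  qed
  then have "?Q (LEAST t. ?Q t)" by (rule LeastI_ex)
  moreover from this obtain d where "(LEAST t. ?Q t) = Suc d" using gr0_conv_Suc by blast
  ultimately show ?thesis using that(2)[of d] True by (simp add: power_propagation_time_def)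
qed

theorem theorem5p6:
  fixes G :: "('a, 'b) pre_digraph"
  assumes "graph G"
    and "verts G \<noteq> {}"
    and "Digraph_Component.connected G"
    and "unit_interval_graph G"
  shows "product_power_throttling_number G = enat (domination_number G)"
proof -
  obtain f where "umbrella_ordered_graph G f (card (verts G))"
    using connected_unit_interval_graph_umbrella_ordered[OF assms(1,3,4)] .
  then interpret umbrella_ordered_graph G f "card (verts G)" .
  let ?c = "\<lambda>S. enat (card S) * power_propagation_time G S"
  let ?F = "{S. S \<noteq> {} \<and> S \<subseteq> verts G}"
  have fin: "finite (?c ` ?F)"
    by (intro finite_imageI finite_subset[of ?F "Pow (verts G)"]) auto
  have lower: "enat (domination_number G) \<le> ?c S" if S: "S \<in> ?F" for S
  proof (cases rule: power_propagation_time_cases[of S])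
    case 1
    \<comment> \<open>In \<open>enat\<close> the product of 0 and \<infinity> is 0, so the infinite
      case needs a nonzero cardinality.\<close>
    have "card S \<noteq> 0" using S finite_subset[of S "verts G"] by auto
    then show ?thesis using 1 by (simp add: zero_enat_def)
  next
    case (2 d)
    obtain D where "dominating_set G D" "card D \<le> card S * Suc d"
      using dominating_set_of_power_propagation[OF _ 2(2)] S by blast
    then have "domination_number G \<le> card S * Suc d" using domination_number_le by fastforce
    then show ?thesis using 2(1) by simp
  qed
  \<comment> \<open>A minimum dominating set attains the bound: it is nonempty because the graph has
    a vertex, and its propagation time is 1, so its cost is its cardinality.\<close>
  obtain D where D: "dominating_set G D" "card D = domination_number G"
    by (rule minimum_dominating_set)
  have ne: "D \<noteq> {}" using D(1) assms(2) by (auto simp: dominating_set_def closed_nbhd_def)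
  have "?c D = enat (domination_number G)"
    by (simp only: power_propagation_time_dominating_set[OF D(1) ne] D(2) mult_1_right)
  moreover have "?c D \<in> ?c ` ?F" using D(1) ne by (intro imageI) (simp add: dominating_set_def)
  ultimately have "enat (domination_number G) \<in> ?c ` ?F" by argo
  then show ?thesis
    unfolding product_power_throttling_number_def using fin lower by (intro Min_eqI) auto
qed

end
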